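(* Let $G=(V,E)$ be an infinite, locally finite, connected graph, and let $\Delta_{bd}$ be its bounded Laplacian. If $v:V\to\mathbf{R}$ is a positive function satisfying $\Delta_{bd}v(x)=\lambda v(x)$ for all $x\in V$, for a constant $\lambda<0$, then $v$ is unbounded.
   Context: For a vertex $x$, $m(x)$ denotes its valence (number of edges at $x$) and $y\sim x$ means that $x,y$ are joined by an edge. The bounded Laplacian is $\Delta_{bd}f(x)=f(x)-\frac{1}{m(x)}\sum_{y\sim x}f(y)$. *)

theory Defs
  imports "HOL-Analysis.Analysis"
begin

text \<open>
  A graph is simple and undirected: a vertex set \<open>V\<close> and a set \<open>E\<close> of two-element
  subsets of \<open>V\<close> (no loops, no multiple edges).
\<close>

definition graph :: "'a set \<Rightarrow> 'a set set \<Rightarrow> bool" where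
  "graph V E \<longleftrightarrow> (\<forall>e\<in>E. e \<subseteq> V \<and> card e = 2)"

definition edges_at :: "'a set set \<Rightarrow> 'a \<Rightarrow> 'a set set" where
  "edges_at E x = {e \<in> E. x \<in> e}"

definition valence :: "'a set set \<Rightarrow> 'a \<Rightarrow> nat" where
  "valence E x = card (edges_at E x)"

definition adjacent :: "'a set set \<Rightarrow> 'a \<Rightarrow> 'a \<Rightarrow> bool" where
  "adjacent E x y \<longleftrightarrow> {x, y} \<in> E"

definition locally_finite_graph :: "'a set \<Rightarrow> 'a set set \<Rightarrow> bool" where
  "locally_finite_graph V E \<longleftrightarrow> (\<forall>x\<in>V. finite (edges_at E x))"

definition connected_graph :: "'a set \<Rightarrow> 'a set set \<Rightarrow> bool" where
  "connected_graph V E \<longleftrightarrow> (\<forall>x\<in>V. \<forall>y\<in>V. (adjacent E)\<^sup>*\<^sup>* x y)"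

text \<open>
  For a graph on \<open>V\<close> the sum below only involves vertices in \<open>V\<close>. Local finiteness makes
  it a finite sum, and the valence is nonzero in a connected graph with at least two vertices,
  so the conventions for infinite sums and division by zero play no role there.
\<close>

definition bounded_laplacian :: "'a set set \<Rightarrow> ('a \<Rightarrow> real) \<Rightarrow> 'a \<Rightarrow> real" where
  "bounded_laplacian E f x =
     f x - 1 / real (valence E x) * (\<Sum>y | adjacent E y x. f y)"

end

theory Submission
  imports Defs
begin

text \<open>
  The mean of \<open>v\<close> over the neighbours of \<open>x\<close> is \<open>(1 - lam) * v x\<close>. If \<open>v\<close> had a finite
  supremum \<open>S\<close>, these means would be at most \<open>S\<close>, so \<open>(1 - lam) * S \<le> S\<close>, which is
  impossible for \<open>S > 0\<close> and \<open>lam < 0\<close>.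
\<close>

lemma adjacent_in_vertices:
  assumes "graph V E" "adjacent E y x"
  shows "y \<in> V"
  using assms unfolding graph_def adjacent_def by blast

text \<open>Sending a neighbour \<open>y\<close> to the edge \<open>{y, x}\<close> is injective,
  with values in the edges at \<open>x\<close>.\<close>

lemma card_neighbours_le_valence:
  assumes "finite (edges_at E x)"
  shows "card {y. adjacent E y x} \<le> valence E x"
  unfolding valence_def
proof (rule card_inj_on_le[OF _ _ assms])
  show "inj_on (\<lambda>y. {y, x}) {y. adjacent E y x}"
    by (auto simp: inj_on_def doubleton_eq_iff)
  show "(\<lambda>y. {y, x}) ` {y. adjacent E y x} \<subseteq> edges_at E x"
    by (auto simp: adjacent_def edges_at_def)
qed

lemma neighbour_mean_le:
  assumes "graph V E" "finite (edges_at E x)" "0 \<le> S" "\<And>y. y \<in> V \<Longrightarrow> f y \<le> S"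
  shows "1 / real (valence E x) * (\<Sum>y | adjacent E y x. f y) \<le> S"
proof -
  have "(\<Sum>y | adjacent E y x. f y) \<le> real (card {y. adjacent E y x}) * S"
    using assms(4) adjacent_in_vertices[OF assms(1)] by (intro sum_bounded_above) auto
  also have "\<dots> \<le> real (valence E x) * S"
    using card_neighbours_le_valence[OF assms(2)] assms(3) by (intro mult_right_mono) auto
  \<comment> \<open>At valence 0 the factor \<open>1 / 0\<close> is 0 in HOL, so the left side
    vanishes and \<open>0 \<le> S\<close> suffices.\<close>
  finally show ?thesis
    using assms(3) by (cases "valence E x = 0") (simp_all add: field_simps)
qed

theorem theorem3p6p1:
  fixes V :: "'a set" and E :: "'a set set" and v :: "'a \<Rightarrow> real" and lam :: real
  assumes "graph V E" and "infinite V" and "locally_finite_graph V E" and "connected_graph V E"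
    and "lam < 0"
    and "\<And>x. x \<in> V \<Longrightarrow> v x > 0"
    and "\<And>x. x \<in> V \<Longrightarrow> bounded_laplacian E v x = lam * v x"
  shows "\<not> bounded (v ` V)"
proof
  assume "bounded (v ` V)"
  then have bdd: "bdd_above (v ` V)"
    by (rule bounded_imp_bdd_above)
  define S where "S = Sup (v ` V)"
  have le_S: "v x \<le> S" if "x \<in> V" for x
    unfolding S_def using that bdd by (intro cSup_upper) auto
  obtain x0 where "x0 \<in> V"
    using assms(2) by fastforce
  then have "0 < S"
    using assms(6) le_S by fastforce
  \<comment> \<open>As \<open>1 - lam > 1\<close> and \<open>S > 0\<close>, this uniform bound lies
    strictly below \<open>S\<close>.\<close>
  have "v x \<le> S / (1 - lam)" if "x \<in> V" for x
  proof -
    have "finite (edges_at E x)"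
      using assms(3) that by (simp add: locally_finite_graph_def)
    then have "1 / real (valence E x) * (\<Sum>y | adjacent E y x. v y) \<le> S"
      using assms(1) \<open>0 < S\<close> le_S by (intro neighbour_mean_le) auto
    then have "v x - lam * v x \<le> S"
      using assms(7)[OF that] unfolding bounded_laplacian_def by linarith
    then show ?thesis
      using assms(5) by (simp add: field_simps)
  qed
  \<comment> \<open>The bound holds at every vertex, so it passes to the least upper bound
    \<open>S\<close>, whether or not \<open>v\<close> attains it.\<close>
  then have "S \<le> S / (1 - lam)"
    unfolding S_def using \<open>x0 \<in> V\<close> by (intro cSup_least) (auto simp: S_def)
  then have "S * (1 - lam) \<le> S"
    using assms(5) by (simp add: pos_le_divide_eq)
  moreover have "S * lam < 0"
    using \<open>0 < S\<close> assms(5) by (rule mult_pos_neg)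
  ultimately show False
    by (simp add: algebra_simps)
qed

end
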